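(* There exists a semigroup $S$ that is embeddable in a group and for which the relation $\sim_p$ is not transitive.
   Context: For a semigroup $S$ and $a,b\in S$, $a\sim_p b$ iff there exist $u,v\in S$ such that $a=uv$ and $b=vu$. A semigroup is embeddable in a group if there is an injective semigroup homomorphism from it into a group. *)

theory Defs
  imports "HOL-Algebra.Group"
begin

text \<open>Semigroups are carried by the \<open>monoid\<close> records of HOL-Algebra, so that \<open>hom\<close> applies;
  the \<open>one\<close> field is unconstrained and never used.\<close>

locale carrier_semigroup =
  fixes S (structure)
  assumes m_closed: "\<lbrakk>x \<in> carrier S; y \<in> carrier S\<rbrakk> \<Longrightarrow> x \<otimes> y \<in> carrier S"
    and m_assoc: "\<lbrakk>x \<in> carrier S; y \<in> carrier S; z \<in> carrier S\<rbrakk>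
      \<Longrightarrow> (x \<otimes> y) \<otimes> z = x \<otimes> (y \<otimes> z)"

definition p_conj :: "('a, 'm) monoid_scheme \<Rightarrow> 'a \<Rightarrow> 'a \<Rightarrow> bool" where
  "p_conj S a b \<longleftrightarrow>
    (\<exists>u\<in>carrier S. \<exists>v\<in>carrier S. a = u \<otimes>\<^bsub>S\<^esub> v \<and> b = v \<otimes>\<^bsub>S\<^esub> u)"

text \<open>The group is taken over the element type of \<open>S\<close>, which loses no generality. Let \<open>S\<close> embed
  in a group over some other type. If \<open>'a\<close> is infinite, the subgroup generated by the image of
  \<open>S\<close> has cardinality at most that of \<open>'a\<close>. If \<open>'a\<close> is finite and \<open>S\<close> is nonempty, then \<open>S\<close> is a
  finite cancellative semigroup, hence a group itself.\<close>

definition embeddable_in_group :: "('a, 'm) monoid_scheme \<Rightarrow> bool" where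
  "embeddable_in_group S \<longleftrightarrow>
    (\<exists>(G :: 'a monoid) h. group G \<and> h \<in> hom S G \<and> inj_on h (carrier S))"

end

theory Submission
  imports Defs "HOL-Library.Countable"
begin

text \<open>The witness lies in the integral Heisenberg group, whose elements are triples with
  \<open>(x, y, z) (x', y', z') = (x + x', y + y', z + z' + x y')\<close>. There a product of two elements
  depends on their order only through the central coordinate, so a step of \<open>\<sim>\<^sub>p\<close> changes that
  coordinate alone. Put \<open>u = (1, 0, 0)\<close>, \<open>v = (0, 1, 0)\<close> and \<open>t = (0, 1, -1)\<close>. Then
  \<open>u v = (1, 1, 1)\<close>, \<open>v u = u t = (1, 1, 0)\<close> and \<open>t u = (1, 1, -1)\<close>, so in every subsemigroup
  that contains \<open>u\<close>, \<open>v\<close>, \<open>t\<close> we have \<open>u v \<sim>\<^sub>p v u\<close> and \<open>u t \<sim>\<^sub>p t u\<close>. In the whole group \<open>u v\<close>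
  and \<open>t u\<close> are conjugate too, so the subsemigroup must be too small for a direct step between
  them.

  The homomorphism \<open>(x, y, z) \<mapsto> x + y\<close> to the integers serves as a degree. The set that consists
  of \<open>u\<close>, \<open>v\<close>, \<open>t\<close> and of all elements of degree at least \<open>2\<close> is closed under products for
  trivial reasons. Its elements have degree at least \<open>1\<close>, so an element of degree \<open>2\<close> factors
  only as a product of two of \<open>u\<close>, \<open>v\<close>, \<open>t\<close>. The only such factorization of \<open>u v\<close> is the visible
  one, and reversing it gives \<open>v u \<noteq> t u\<close>. Hence \<open>u v \<sim>\<^sub>p t u\<close> fails.

  Since \<open>u v \<noteq> t u\<close>, this is not an artefact of \<open>\<sim>\<^sub>p\<close> failing to be reflexive: the relation stays
  non-transitive when one of the two factors may be an adjoined identity.\<close>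

section \<open>Coding countable structures on the natural numbers\<close>

definition nat_copy :: "('a::countable) monoid \<Rightarrow> nat monoid" where
  "nat_copy G = \<lparr>carrier = to_nat ` carrier G,
     mult = (\<lambda>m n. to_nat (from_nat m \<otimes>\<^bsub>G\<^esub> from_nat n)), one = to_nat \<one>\<^bsub>G\<^esub>\<rparr>"

lemma nat_copy_simps [simp]:
  "carrier (nat_copy G) = to_nat ` carrier G"
  "m \<otimes>\<^bsub>nat_copy G\<^esub> n = to_nat (from_nat m \<otimes>\<^bsub>G\<^esub> from_nat n)"
  "\<one>\<^bsub>nat_copy G\<^esub> = to_nat \<one>\<^bsub>G\<^esub>"
  by (simp_all add: nat_copy_def)

lemma group_nat_copy:
  assumes "group G"
  shows "group (nat_copy G)"
proof -
  interpret group G by fact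
  show ?thesis
  proof (rule groupI)
    fix m assume "m \<in> carrier (nat_copy G)"
    then obtain x where x: "x \<in> carrier G" "m = to_nat x" by auto
    show "\<exists>n\<in>carrier (nat_copy G). n \<otimes>\<^bsub>nat_copy G\<^esub> m = \<one>\<^bsub>nat_copy G\<^esub>"
      by (rule bexI[of _ "to_nat (inv\<^bsub>G\<^esub> x)"]) (use x in auto)
  qed (auto simp: m_assoc)
qed

lemma p_conj_nat_copy [simp]:
  "p_conj (nat_copy S) (to_nat a) (to_nat b) \<longleftrightarrow> p_conj S a b"
  by (simp add: p_conj_def)

lemma carrier_semigroup_nat_copy:
  assumes "carrier_semigroup S"
  shows "carrier_semigroup (nat_copy S)"
  using assms by (auto simp: carrier_semigroup_def)

lemma embeddable_nat_copy_subset: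
  assumes "group G" and "A \<subseteq> carrier G"
  shows "embeddable_in_group (nat_copy (G\<lparr>carrier := A\<rparr>))"
  unfolding embeddable_in_group_def
proof (intro exI conjI)
  show "group (nat_copy G)" by (rule group_nat_copy) fact
  show "id \<in> hom (nat_copy (G\<lparr>carrier := A\<rparr>)) (nat_copy G)"
    using assms(2) by (auto simp: hom_def)
qed simp

section \<open>The Heisenberg group and a subsemigroup with few factorizations\<close>

definition heisenberg :: "(int \<times> int \<times> int) monoid" where
  "heisenberg = \<lparr>carrier = UNIV,
     mult = (\<lambda>(x, y, z) (x', y', z'). (x + x', y + y', z + z' + x * y')), one = (0, 0, 0)\<rparr>"

lemma heisenberg_simps [simp]:
  "carrier heisenberg = UNIV"
  "(x, y, z) \<otimes>\<^bsub>heisenberg\<^esub> (x', y', z') = (x + x', y + y', z + z' + x * y')"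
  "\<one>\<^bsub>heisenberg\<^esub> = (0, 0, 0)"
  by (simp_all add: heisenberg_def)

lemma group_heisenberg: "group heisenberg"
proof (rule groupI)
  fix g assume "g \<in> carrier heisenberg"
  obtain x y z where g: "g = (x, y, z)" by (cases g)
  show "\<exists>h\<in>carrier heisenberg. h \<otimes>\<^bsub>heisenberg\<^esub> g = \<one>\<^bsub>heisenberg\<^esub>"
    by (rule bexI[of _ "(- x, - y, x * y - z)"]) (simp_all add: g)
qed (auto simp: algebra_simps)

text \<open>Degree \<open>1\<close> is restricted to the three elements needed for the two \<open>\<sim>\<^sub>p\<close>-steps; keeping
  everything of degree at least \<open>2\<close>, rather than only the products of these three, makes closure
  immediate and adds no factorization of an element of degree \<open>2\<close>.\<close>

definition witness_set :: "(int \<times> int \<times> int) set" where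
  "witness_set = {(1, 0, 0), (0, 1, 0), (0, 1, -1)} \<union> {(x, y, z). x + y \<ge> 2}"

abbreviation witness :: "(int \<times> int \<times> int) monoid" where
  "witness \<equiv> heisenberg\<lparr>carrier := witness_set\<rparr>"

lemma carrier_semigroup_witness: "carrier_semigroup witness"
proof
  fix g h assume gh: "g \<in> carrier witness" "h \<in> carrier witness"
  obtain x y z x' y' z' where eq: "g = (x, y, z)" "h = (x', y', z')"
    by (cases g, cases h)
  have "x + y \<ge> 1" "x' + y' \<ge> 1"
    using gh by (auto simp: witness_set_def eq)
  then show "g \<otimes>\<^bsub>witness\<^esub> h \<in> carrier witness"
    by (simp add: witness_set_def eq)
qed (auto simp: algebra_simps)

lemma p_conj_witness_steps:
  "p_conj witness (1, 1, 1) (1, 1, 0)"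
  "p_conj witness (1, 1, 0) (1, 1, -1)"
proof -
  show "p_conj witness (1, 1, 1) (1, 1, 0)"
    unfolding p_conj_def
    by (rule bexI[of _ "(1, 0, 0)"], rule bexI[of _ "(0, 1, 0)"]) (simp_all add: witness_set_def)
  show "p_conj witness (1, 1, 0) (1, 1, -1)"
    unfolding p_conj_def
    by (rule bexI[of _ "(1, 0, 0)"], rule bexI[of _ "(0, 1, -1)"]) (simp_all add: witness_set_def)
qed

text \<open>Both factors of an element of degree \<open>2\<close> have degree \<open>1\<close>, so only nine products have to be
  compared.\<close>

lemma not_p_conj_witness: "\<not> p_conj witness (1, 1, 1) (1, 1, -1)"
proof
  assume "p_conj witness (1, 1, 1) (1, 1, -1)"
  then obtain g h where gh: "g \<in> witness_set" "h \<in> witness_set"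
    and prod: "(1, 1, 1) = g \<otimes>\<^bsub>heisenberg\<^esub> h" "(1, 1, -1) = h \<otimes>\<^bsub>heisenberg\<^esub> g"
    by (auto simp: p_conj_def)
  obtain x y z x' y' z' where eq: "g = (x, y, z)" "h = (x', y', z')"
    by (cases g, cases h)
  have "x + y \<ge> 1" "x' + y' \<ge> 1"
    using gh by (auto simp: witness_set_def eq)
  moreover have "(x + y) + (x' + y') = 2"
    using prod by (simp add: eq)
  ultimately have "x + y = 1" "x' + y' = 1"
    by linarith+
  then have "g \<in> {(1, 0, 0), (0, 1, 0), (0, 1, -1)}" "h \<in> {(1, 0, 0), (0, 1, 0), (0, 1, -1)}"
    using gh by (auto simp: witness_set_def eq)
  then show False
    using prod by auto
qed

theorem corollary5p2:
  "\<exists>S :: nat monoid. carrier_semigroup S \<and> embeddable_in_group S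
      \<and> \<not> transp_on (carrier S) (p_conj S)"
proof (intro exI conjI)
  show "carrier_semigroup (nat_copy witness)"
    by (rule carrier_semigroup_nat_copy[OF carrier_semigroup_witness])
  show "embeddable_in_group (nat_copy witness)"
    by (rule embeddable_nat_copy_subset)
      (simp_all add: group_heisenberg)
  show "\<not> transp_on (carrier (nat_copy witness)) (p_conj (nat_copy witness))"
  proof
    assume trans: "transp_on (carrier (nat_copy witness)) (p_conj (nat_copy witness))"
    have mem: "to_nat (1 :: int, 1 :: int, k :: int) \<in> carrier (nat_copy witness)" for k
      by (simp add: witness_set_def)
    have "p_conj (nat_copy witness) (to_nat (1 :: int, 1 :: int, 1 :: int))
        (to_nat (1 :: int, 1 :: int, -1 :: int))"
      by (rule transp_onD[OF trans mem mem mem, of _ 0])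
        (simp_all only: p_conj_nat_copy p_conj_witness_steps)
    then show False
      by (simp only: p_conj_nat_copy not_p_conj_witness)
  qed
qed

end
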